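(* Let $G$ be a finite simple connected graph with non-empty vertex set. Then the following assertions are equivalent: (i) $G$ is square-stable, i.e. $\alpha(G)=\alpha(G^2)$; (ii) there exists $S_0\in\Omega(G)$ that has property P1; (iii) every $S\in\Omega(G^2)$ has property P1; (iv) for all $S_1\in\Omega(G)$ and $S_2\in\Omega(G^2)$, the graph $G[S_1\bigtriangleup S_2]$ has a unique perfect matching; (v) for all $S_1\in\Omega(G)$ and $S_2\in\Omega(G^2)$, the graph $G[S_1\bigtriangleup S_2]$ has a perfect matching; (vi) for all $S_1\in\Omega(G)$ and $S_2\in\Omega(G^2)$, the graph $G[S_1\bigtriangleup S_2]$ has an induced perfect matching.
   Context: $G^2$ is the graph on $V(G)$ in which distinct vertices $v,w$ are adjacent iff $\mathrm{dist}_G(v,w)\le 2$. A stable set is a set of pairwise non-adjacent vertices; $\alpha(G)$ is the maximum cardinality of a stable set; $\Omega(G)$ is the set of all maximum (cardinality) stable sets of $G$. $G[X]$ is the subgraph induced by $X$, and $A\bigtriangleup B=(A-B)\cup(B-A)$. The graph on the empty vertex set has the empty perfect matching. A matching $M$ of $G$ is induced if no edge of $G$ joins endpoints of two different edges of $M$. A stable set $S$ of $G$ has property P1 if for every stable set $A$ of $G$ disjoint from $S$, $A$ can be uniquely matched into $S$: there is exactly one matching, consisting of edges of $G$ with one end in $A$ and the other in $S$, that saturates all vertices of $A$. *)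

theory Defs
  imports "Graph_Theory.Graph_Theory"
begin

text \<open>
  Finite simple graphs are the library's \<^locale>\<open>graph\<close>: finite, loop-free, symmetric digraphs
  without parallel arcs. An undirected edge is thus a pair of opposite arcs; it is represented
  below by the set of its two ends.
\<close>

definition edges :: "('a,'b) pre_digraph \<Rightarrow> 'a set set" where
  "edges G = {{u, v} | u v. u \<rightarrow>\<^bsub>G\<^esub> v}"

text \<open>The distance is the library's minimal walk cost for unit arc weights, hence extended-real.\<close>

definition graph_dist :: "('a,'b) pre_digraph \<Rightarrow> 'a \<Rightarrow> 'a \<Rightarrow> ereal" where
  "graph_dist G u v = wf_digraph.\<mu> G (\<lambda>_. 1) u v"

definition square :: "('a,'b) pre_digraph \<Rightarrow> ('a, 'a \<times> 'a) pre_digraph" where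
  "square G = with_proj
    \<lparr> pverts = verts G,
      parcs = {(v, w). v \<in> verts G \<and> w \<in> verts G \<and> v \<noteq> w \<and> graph_dist G v w \<le> 2} \<rparr>"

definition stable :: "('a,'b) pre_digraph \<Rightarrow> 'a set \<Rightarrow> bool" where
  "stable G S \<longleftrightarrow> S \<subseteq> verts G \<and> pairwise (\<lambda>u v. \<not> u \<rightarrow>\<^bsub>G\<^esub> v) S"

definition stability_number :: "('a,'b) pre_digraph \<Rightarrow> nat" where
  "stability_number G = Max (card ` {S. stable G S})"

definition max_stable_sets :: "('a,'b) pre_digraph \<Rightarrow> 'a set set" where
  "max_stable_sets G = {S. stable G S \<and> card S = stability_number G}"

definition square_stable :: "('a,'b) pre_digraph \<Rightarrow> bool" where
  "square_stable G \<longleftrightarrow> stability_number G = stability_number (square G)"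

definition matching :: "('a,'b) pre_digraph \<Rightarrow> 'a set set \<Rightarrow> bool" where
  "matching G M \<longleftrightarrow> M \<subseteq> edges G \<and> pairwise disjnt M"

definition perfect_matching :: "('a,'b) pre_digraph \<Rightarrow> 'a set set \<Rightarrow> bool" where
  "perfect_matching G M \<longleftrightarrow> matching G M \<and> \<Union>M = verts G"

definition induced_matching :: "('a,'b) pre_digraph \<Rightarrow> 'a set set \<Rightarrow> bool" where
  "induced_matching G M \<longleftrightarrow> matching G M \<and>
    (\<forall>e\<in>M. \<forall>f\<in>M. e \<noteq> f \<longrightarrow> (\<forall>x\<in>e. \<forall>y\<in>f. {x, y} \<notin> edges G))"

definition matches_into :: "('a,'b) pre_digraph \<Rightarrow> 'a set set \<Rightarrow> 'a set \<Rightarrow> 'a set \<Rightarrow> bool" where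
  "matches_into G M A S \<longleftrightarrow>
    matching G M \<and> (\<forall>e\<in>M. \<exists>a\<in>A. \<exists>s\<in>S. e = {a, s}) \<and> A \<subseteq> \<Union>M"

definition property_P1 :: "('a,'b) pre_digraph \<Rightarrow> 'a set \<Rightarrow> bool" where
  "property_P1 G S \<longleftrightarrow>
    (\<forall>A. stable G A \<and> A \<inter> S = {} \<longrightarrow> (\<exists>!M. matches_into G M A S))"

end

theory Submission
  imports Defs
begin

text \<open>
  A set is stable in the square of \<open>G\<close> iff it is stable in \<open>G\<close> and no vertex of \<open>G\<close> has two
  neighbours in it (\<open>stable_square_iff\<close>). In particular \<open>\<alpha>(G\<^sup>2) \<le> \<alpha>(G)\<close>, and \<open>G\<close> is square-stable
  iff some maximum stable set of \<open>G\<close> is stable in the square.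

  For a maximum stable set \<open>S\<close>, property P1 is the same as stability in the square
  (\<open>property_P1_iff_stable_square\<close>). Matching single vertices uniquely into \<open>S\<close> forbids two
  neighbours in \<open>S\<close>. Conversely, if neighbours in \<open>S\<close> are unique, then a matching of \<open>A\<close> into \<open>S\<close>
  has no choice but to send each vertex of \<open>A\<close> to its neighbour, and this does give a
  matching: two vertices of \<open>A\<close> with the same neighbour could replace it in \<open>S\<close>, producing a
  larger stable set.

  Finally, if \<open>S\<^sub>1\<close> and \<open>S\<^sub>2\<close> are stable, then a perfect matching of their symmetric difference
  matches \<open>S\<^sub>1 - S\<^sub>2\<close> into \<open>S\<^sub>2\<close>, and so shows \<open>|S\<^sub>1| \<le> |S\<^sub>2|\<close>; if the two cardinalities agree, every
  matching of \<open>S\<^sub>1 - S\<^sub>2\<close> into \<open>S\<^sub>2\<close> arises in this way (\<open>perfect_matching_sym_diff_iff\<close>). With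
  \<open>S\<^sub>1\<close> maximum in \<open>G\<close> and \<open>S\<^sub>2\<close> maximum in the square, the existence of one perfect matching thus
  forces \<open>\<alpha>(G) \<le> \<alpha>(G\<^sup>2)\<close>. Conversely, square-stability makes \<open>S\<^sub>2\<close> a maximum stable set of \<open>G\<close> with P1,
  which yields exactly one perfect matching; it is induced because all edges between
  \<open>S\<^sub>1 - S\<^sub>2\<close> and \<open>S\<^sub>2\<close> belong to it.
\<close>

lemma card_le_stability_number:
  assumes "finite (verts H)" and "stable H S"
  shows "card S \<le> stability_number H"
proof -
  have "finite {S. stable H S}"
    by (rule finite_subset[of _ "Pow (verts H)"]) (use assms(1) in \<open>auto simp: stable_def\<close>)
  then show ?thesis
    unfolding stability_number_def using assms(2) by (intro Max_ge) auto
qed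

lemma max_stable_sets_nonempty:
  assumes "finite (verts H)"
  shows "max_stable_sets H \<noteq> {}"
proof -
  have "finite {S. stable H S}"
    by (rule finite_subset[of _ "Pow (verts H)"]) (use assms in \<open>auto simp: stable_def\<close>)
  moreover have "stable H {}"
    by (simp add: stable_def)
  ultimately have "stability_number H \<in> card ` {S. stable H S}"
    unfolding stability_number_def by (intro Max_in) auto
  then show ?thesis
    by (auto simp: max_stable_sets_def)
qed

lemma dominates_induce_subgraph_iff:
  "u \<rightarrow>\<^bsub>H \<restriction> X\<^esub> v \<longleftrightarrow> u \<rightarrow>\<^bsub>H\<^esub> v \<and> u \<in> X \<and> v \<in> X"
  by (auto simp: arcs_ends_def arc_to_ends_def)

lemma stable_subset: "stable H S \<Longrightarrow> T \<subseteq> S \<Longrightarrow> stable H T"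
  unfolding stable_def using pairwise_subset by (meson order_trans)

lemma property_P1D:
  assumes "property_P1 H S" and "stable H A" and "A \<inter> S = {}"
  shows "\<exists>!M. matches_into H M A S"
  using assms unfolding property_P1_def by simp

lemma stable_not_dominates:
  assumes "stable H S" and "u \<in> S" and "v \<in> S" and "u \<noteq> v"
  shows "\<not> u \<rightarrow>\<^bsub>H\<^esub> v"
  using assms by (auto simp: stable_def pairwise_def)

context graph
begin

lemma edge_iff_dominates: "{u, v} \<in> edges G \<longleftrightarrow> u \<rightarrow>\<^bsub>G\<^esub> v"
  using graph_symmetric by (auto simp: edges_def doubleton_eq_iff)

lemma edge_induce_subgraph_iff:
  "e \<in> edges (G \<restriction> X) \<longleftrightarrow> e \<in> edges G \<and> e \<subseteq> X"
  unfolding edges_def mem_Collect_eq dominates_induce_subgraph_iff by blast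

lemma stable_no_edge:
  assumes "stable G S" and "u \<in> S" and "v \<in> S"
  shows "\<not> u \<rightarrow>\<^bsub>G\<^esub> v"
  using stable_not_dominates[OF assms] adj_not_same by blast

lemma finite_stable: "stable G S \<Longrightarrow> finite S"
  by (rule finite_subset[OF _ finite_verts]) (simp add: stable_def)

section \<open>Stability in the square\<close>

lemma graph_dist_le_2_iff:
  assumes "u \<noteq> v"
  shows "graph_dist G u v \<le> 2 \<longleftrightarrow> u \<rightarrow>\<^bsub>G\<^esub> v \<or> (\<exists>w. u \<rightarrow>\<^bsub>G\<^esub> w \<and> w \<rightarrow>\<^bsub>G\<^esub> v)"
proof
  assume "graph_dist G u v \<le> 2"
  \<comment> \<open>The infimum need not be attained a priori; but any walk of cost below 3 has length at most 2.\<close>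
  then have "graph_dist G u v < 3"
    by (rule le_less_trans) simp
  then obtain p where p: "awalk u p v" and "ereal (awalk_cost (\<lambda>_. 1) p) < 3"
    unfolding graph_dist_def \<mu>_def INF_less_iff by blast
  then have "length p < 3"
    by (simp add: awalk_cost_def sum_list_triv)
  moreover have "p \<noteq> []"
    using p assms by (auto simp: awalk_def)
  ultimately consider a where "p = [a]" | a b where "p = [a, b]"
    by (cases p rule: remdups_adj.cases) auto
  then show "u \<rightarrow>\<^bsub>G\<^esub> v \<or> (\<exists>w. u \<rightarrow>\<^bsub>G\<^esub> w \<and> w \<rightarrow>\<^bsub>G\<^esub> v)"
  proof cases
    case (1 a)
    then show ?thesis
      using p in_arcs_imp_in_arcs_ends[of a] by (auto simp: awalk_Cons_iff awalk_Nil_iff)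
  next
    case (2 a b)
    then show ?thesis
      using p in_arcs_imp_in_arcs_ends[of a] in_arcs_imp_in_arcs_ends[of b]
      by (auto simp: awalk_Cons_iff awalk_Nil_iff)
  qed
next
  have dist_le: "graph_dist G u v \<le> length p" if "awalk u p v" for p
    using min_cost_le_walk_cost[OF that, of "\<lambda>_. 1"]
    by (simp add: graph_dist_def awalk_cost_def sum_list_triv)
  assume "u \<rightarrow>\<^bsub>G\<^esub> v \<or> (\<exists>w. u \<rightarrow>\<^bsub>G\<^esub> w \<and> w \<rightarrow>\<^bsub>G\<^esub> v)"
  then show "graph_dist G u v \<le> 2"
  proof (elim disjE exE conjE)
    assume "u \<rightarrow>\<^bsub>G\<^esub> v"
    then obtain a where "a \<in> arcs G" "tail G a = u" "head G a = v"
      by (auto simp: arcs_ends_conv)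
    then have "graph_dist G u v \<le> 1"
      using dist_le[of "[a]"] by (auto simp: awalk_Cons_iff awalk_Nil_iff one_ereal_def)
    then show ?thesis
      by (rule order_trans) simp
  next
    fix w assume "u \<rightarrow>\<^bsub>G\<^esub> w" "w \<rightarrow>\<^bsub>G\<^esub> v"
    then obtain a b where "a \<in> arcs G" "tail G a = u" "head G a = w"
        "b \<in> arcs G" "tail G b = w" "head G b = v"
      by (auto simp: arcs_ends_conv)
    then show ?thesis
      using dist_le[of "[a, b]"] by (auto simp: awalk_Cons_iff awalk_Nil_iff)
  qed
qed

lemma dominates_square_iff:
  "u \<rightarrow>\<^bsub>square G\<^esub> v \<longleftrightarrow> u \<noteq> v \<and> (u \<rightarrow>\<^bsub>G\<^esub> v \<or> (\<exists>w. u \<rightarrow>\<^bsub>G\<^esub> w \<and> w \<rightarrow>\<^bsub>G\<^esub> v))"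
proof -
  have "u \<rightarrow>\<^bsub>square G\<^esub> v \<longleftrightarrow>
      u \<in> verts G \<and> v \<in> verts G \<and> u \<noteq> v \<and> graph_dist G u v \<le> 2"
    by (auto simp: square_def arcs_ends_def arc_to_ends_def)
  then show ?thesis
    using graph_dist_le_2_iff[of u v] adj_in_verts by (cases "u = v") auto
qed

text \<open>
  Beyond the edges of \<open>G\<close>, the square joins the ends of each path of length two; the middle of such
  a path is a vertex with two neighbours. This turns stability in the square into a condition on
  neighbourhoods in \<open>G\<close>, the form in which it is used throughout.
\<close>

lemma stable_square_iff:
  "stable (square G) S \<longleftrightarrow>
    stable G S \<and> (\<forall>v. \<forall>s\<in>S. \<forall>t\<in>S. v \<rightarrow>\<^bsub>G\<^esub> s \<longrightarrow> v \<rightarrow>\<^bsub>G\<^esub> t \<longrightarrow> s = t)"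
proof
  assume S: "stable (square G) S"
  have no_dominates: "\<not> s \<rightarrow>\<^bsub>square G\<^esub> t" if "s \<in> S" "t \<in> S" for s t
    using stable_not_dominates[OF S that] dominates_square_iff by blast
  have "S \<subseteq> verts G"
    using S by (simp add: stable_def square_def)
  moreover have "\<not> s \<rightarrow>\<^bsub>G\<^esub> t" if "s \<in> S" "t \<in> S" "s \<noteq> t" for s t
    using no_dominates[of s t] that by (simp add: dominates_square_iff)
  ultimately have "stable G S"
    by (simp add: stable_def pairwise_def)
  moreover have "s = t" if "s \<in> S" "t \<in> S" "v \<rightarrow>\<^bsub>G\<^esub> s" "v \<rightarrow>\<^bsub>G\<^esub> t" for s t v
    using no_dominates[of s t] that graph_symmetric[of v s] by (auto simp: dominates_square_iff)
  ultimately show "stable G S \<and> (\<forall>v. \<forall>s\<in>S. \<forall>t\<in>S. v \<rightarrow>\<^bsub>G\<^esub> s \<longrightarrow> v \<rightarrow>\<^bsub>G\<^esub> t \<longrightarrow> s = t)"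
    by blast
next
  assume S: "stable G S \<and> (\<forall>v. \<forall>s\<in>S. \<forall>t\<in>S. v \<rightarrow>\<^bsub>G\<^esub> s \<longrightarrow> v \<rightarrow>\<^bsub>G\<^esub> t \<longrightarrow> s = t)"
  have "\<not> s \<rightarrow>\<^bsub>square G\<^esub> t" if st: "s \<in> S" "t \<in> S" "s \<noteq> t" for s t
  proof
    assume "s \<rightarrow>\<^bsub>square G\<^esub> t"
    then consider "s \<rightarrow>\<^bsub>G\<^esub> t" | w where "s \<rightarrow>\<^bsub>G\<^esub> w" "w \<rightarrow>\<^bsub>G\<^esub> t"
      unfolding dominates_square_iff by blast
    then show False
    proof cases
      case 1
      then show ?thesis
        using stable_no_edge[of S s t] S st by simp
    next
      case (2 w)
      then show ?thesis
        using S st graph_symmetric[of s w] by blast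
    qed
  qed
  then show "stable (square G) S"
    using S by (simp add: stable_def pairwise_def square_def)
qed

lemma finite_verts_square: "finite (verts (square G))"
  by (simp add: square_def)

lemma stability_number_square_le: "stability_number (square G) \<le> stability_number G"
proof -
  obtain S where S: "S \<in> max_stable_sets (square G)"
    using max_stable_sets_nonempty[OF finite_verts_square] by blast
  then have "stable G S"
    by (simp add: max_stable_sets_def stable_square_iff)
  then have "card S \<le> stability_number G"
    by (rule card_le_stability_number[OF finite_verts])
  then show ?thesis
    using S by (simp add: max_stable_sets_def)
qed

lemma square_stableI:
  assumes "stability_number G \<le> stability_number (square G)"
  shows "square_stable G"
  using assms stability_number_square_le by (simp add: square_stable_def)

lemma square_stable_iff_max_stable_square:
  "square_stable G \<longleftrightarrow> (\<exists>S \<in> max_stable_sets G. stable (square G) S)"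
proof
  assume "square_stable G"
  moreover obtain S where "S \<in> max_stable_sets (square G)"
    using max_stable_sets_nonempty[OF finite_verts_square] by blast
  ultimately show "\<exists>S \<in> max_stable_sets G. stable (square G) S"
    by (auto simp: max_stable_sets_def square_stable_def stable_square_iff)
next
  assume "\<exists>S \<in> max_stable_sets G. stable (square G) S"
  then obtain S where "card S = stability_number G" "stable (square G) S"
    by (auto simp: max_stable_sets_def)
  then have "stability_number G \<le> stability_number (square G)"
    using card_le_stability_number[OF finite_verts_square, of S] by simp
  then show "square_stable G"
    by (rule square_stableI)
qed

section \<open>Matchings into stable sets\<close>

lemma matches_intoD:
  assumes "matches_into G M A S"
  shows "M \<subseteq> edges G" and "pairwise disjnt M" and "A \<subseteq> \<Union>M"
    and "e \<in> M \<Longrightarrow> \<exists>a\<in>A. \<exists>s\<in>S. e = {a, s}"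
  using assms by (simp_all add: matches_into_def matching_def)

lemma matches_into_obtain_inj:
  assumes M: "matches_into G M A S" and disj: "A \<inter> S = {}"
  obtains f where "inj_on f A" and "f ` A \<subseteq> S" and "\<And>a. a \<in> A \<Longrightarrow> {a, f a} \<in> M"
proof -
  have "\<exists>s\<in>S. {a, s} \<in> M" if a: "a \<in> A" for a
  proof -
    obtain e where "e \<in> M" "a \<in> e"
      using matches_intoD(3)[OF M] a by blast
    moreover from this obtain a' s where "s \<in> S" "e = {a', s}"
      using matches_intoD(4)[OF M] by metis
    ultimately show ?thesis
      using that disj by auto
  qed
  then obtain f where f: "\<And>a. a \<in> A \<Longrightarrow> f a \<in> S \<and> {a, f a} \<in> M"
    by metis
  have "inj_on f A"
  proof
    fix a b assume ab: "a \<in> A" "b \<in> A" "f a = f b"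
    have "{a, f a} = {b, f b}"
    proof (rule ccontr)
      assume "{a, f a} \<noteq> {b, f b}"
      then have "disjnt {a, f a} {b, f b}"
        using f[OF ab(1)] f[OF ab(2)] pairwiseD[OF matches_intoD(2)[OF M]] by blast
      with ab show False
        by (simp add: disjnt_def)
    qed
    then show "a = b"
      using ab by (auto simp: doubleton_eq_iff)
  qed
  then show ?thesis
    using f that by blast
qed

text \<open>
  The source of all uniqueness claims: when each vertex has at most one neighbour in \<open>S\<close>, the
  matching has no choice, since the edge at \<open>a\<close> can only lead to the neighbour of \<open>a\<close>. So it
  consists of all edges between \<open>A\<close> and \<open>S\<close>.
\<close>

lemma matches_into_eq_edges_between:
  assumes M: "matches_into G M A S" and disj: "A \<inter> S = {}"
    and unique: "\<forall>v. \<forall>s\<in>S. \<forall>t\<in>S. v \<rightarrow>\<^bsub>G\<^esub> s \<longrightarrow> v \<rightarrow>\<^bsub>G\<^esub> t \<longrightarrow> s = t"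
  shows "M = {{a, s} | a s. a \<in> A \<and> s \<in> S \<and> a \<rightarrow>\<^bsub>G\<^esub> s}" (is "_ = ?N")
proof
  have "\<exists>a\<in>A. \<exists>s\<in>S. e = {a, s} \<and> a \<rightarrow>\<^bsub>G\<^esub> s" if e: "e \<in> M" for e
  proof -
    obtain a s where "a \<in> A" "s \<in> S" "e = {a, s}"
      using matches_intoD(4)[OF M e] by metis
    moreover have "e \<in> edges G"
      using matches_intoD(1)[OF M] e by (rule subsetD)
    ultimately show ?thesis
      by (auto simp: edge_iff_dominates)
  qed
  then show "M \<subseteq> ?N"
    by blast
  obtain f where f: "f ` A \<subseteq> S" "\<And>a. a \<in> A \<Longrightarrow> {a, f a} \<in> M"
    using matches_into_obtain_inj[OF M disj] by blast
  have f_eq: "f a = s" if "a \<in> A" "s \<in> S" "a \<rightarrow>\<^bsub>G\<^esub> s" for a s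
  proof -
    have "{a, f a} \<in> edges G"
      using matches_intoD(1)[OF M] f(2)[OF that(1)] by (rule subsetD)
    then show ?thesis
      using unique f(1) that by (auto simp: edge_iff_dominates)
  qed
  show "?N \<subseteq> M"
    using f(2) f_eq by blast
qed

text \<open>
  Exchanging the neighbours of \<open>A\<close> for \<open>A\<close> itself preserves stability, and cannot enlarge a
  maximum stable set. Below this is used for one vertex, which hence has a neighbour in \<open>S\<close>, and
  for two vertices, which hence cannot share their only neighbour.
\<close>

lemma card_le_card_neighbours_in_max_stable:
  assumes S: "S \<in> max_stable_sets G" and A: "stable G A" and disj: "A \<inter> S = {}"
  shows "card A \<le> card {s \<in> S. \<exists>a\<in>A. a \<rightarrow>\<^bsub>G\<^esub> s}" (is "_ \<le> card ?N")
proof -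
  have stS: "stable G S" and cardS: "card S = stability_number G"
    using S by (auto simp: max_stable_sets_def)
  have fin: "finite S" "finite A"
    using finite_stable stS A by auto
  have "stable G ((S - ?N) \<union> A)"
    unfolding stable_def
  proof
    show "(S - ?N) \<union> A \<subseteq> verts G"
      using stS A by (auto simp: stable_def)
    show "pairwise (\<lambda>u v. \<not> u \<rightarrow>\<^bsub>G\<^esub> v) ((S - ?N) \<union> A)"
      using stable_no_edge[OF stS] stable_no_edge[OF A] graph_symmetric
      unfolding pairwise_def by blast
  qed
  then have "card ((S - ?N) \<union> A) \<le> card S"
    using card_le_stability_number[OF finite_verts] cardS by simp
  moreover have "card ((S - ?N) \<union> A) = card (S - ?N) + card A"
    using fin disj by (intro card_Un_disjoint) auto
  moreover have "card (S - ?N) = card S - card ?N"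
    using fin by (intro card_Diff_subset) auto
  moreover have "card ?N \<le> card S"
    using fin by (intro card_mono) auto
  ultimately show ?thesis
    by linarith
qed

text \<open>
  The singleton \<open>{v}\<close> is stable, and each neighbour of \<open>v\<close> in \<open>S\<close> gives a different matching of it
  into \<open>S\<close>.
\<close>

lemma property_P1_neighbours_unique:
  assumes P1: "property_P1 G S" and "v \<in> verts G" "v \<notin> S"
    and st: "s \<in> S" "t \<in> S" "v \<rightarrow>\<^bsub>G\<^esub> s" "v \<rightarrow>\<^bsub>G\<^esub> t"
  shows "s = t"
proof -
  have "stable G {v}"
    using assms(2) by (simp add: stable_def)
  then have "\<exists>!M. matches_into G M {v} S"
    using property_P1D[OF P1] assms(3) by simp
  then obtain N where N: "M = N" if "matches_into G M {v} S" for M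
    by (elim ex1E) metis
  have "matches_into G {{v, x}} {v} S" if "x \<in> S" "v \<rightarrow>\<^bsub>G\<^esub> x" for x
  proof -
    have "{{v, x}} \<subseteq> edges G"
      using that(2) by (simp add: edge_iff_dominates)
    moreover have "\<exists>s\<in>S. {v, x} = {v, s}"
      using that(1) by blast
    ultimately show ?thesis
      by (simp add: matches_into_def matching_def)
  qed
  then have "{{v, s}} = {{v, t}}"
    using st N[of "{{v, s}}"] N[of "{{v, t}}"] by simp
  then show ?thesis
    by (auto simp: doubleton_eq_iff)
qed

lemma property_P1_imp_stable_square:
  assumes S: "stable G S" and P1: "property_P1 G S"
  shows "stable (square G) S"
proof -
  have "s = t" if st: "s \<in> S" "t \<in> S" "v \<rightarrow>\<^bsub>G\<^esub> s" "v \<rightarrow>\<^bsub>G\<^esub> t" for v s t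
  proof (rule property_P1_neighbours_unique[OF P1 _ _ st])
    show "v \<in> verts G"
      using st(3) by (rule adj_in_verts)
    show "v \<notin> S"
      using stable_no_edge[OF S _ st(1)] st(3) by metis
  qed
  then show ?thesis
    using S by (simp add: stable_square_iff)
qed

text \<open>
  The only candidate for the matching is the set of all edges between \<open>A\<close> and \<open>S\<close>. That it
  saturates \<open>A\<close>, and that no two of its edges share an end in \<open>S\<close>, follows from the exchange
  argument, and thus from the maximality of \<open>S\<close> in \<open>G\<close>; stability in the square keeps its edges
  from sharing an end in \<open>A\<close>.
\<close>

lemma stable_square_imp_property_P1:
  assumes S: "S \<in> max_stable_sets G" and T: "stable (square G) S"
  shows "property_P1 G S"
proof -
  have unique: "\<forall>v. \<forall>s\<in>S. \<forall>t\<in>S. v \<rightarrow>\<^bsub>G\<^esub> s \<longrightarrow> v \<rightarrow>\<^bsub>G\<^esub> t \<longrightarrow> s = t"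
    using T by (simp add: stable_square_iff)
  show "property_P1 G S"
    unfolding property_P1_def
  proof (intro allI impI, elim conjE)
    fix A assume A: "stable G A" and disj: "A \<inter> S = {}"
    define M where "M = {{a, s} | a s. a \<in> A \<and> s \<in> S \<and> a \<rightarrow>\<^bsub>G\<^esub> s}"
    have has_neighbour: "\<exists>s\<in>S. a \<rightarrow>\<^bsub>G\<^esub> s" if "a \<in> A" for a
    proof (rule ccontr)
      assume no: "\<not> (\<exists>s\<in>S. a \<rightarrow>\<^bsub>G\<^esub> s)"
      have "card {a} \<le> card {s \<in> S. \<exists>x\<in>{a}. x \<rightarrow>\<^bsub>G\<^esub> s}"
        using that disj by (intro card_le_card_neighbours_in_max_stable[OF S] stable_subset[OF A]) auto
      also have "{s \<in> S. \<exists>x\<in>{a}. x \<rightarrow>\<^bsub>G\<^esub> s} = {}"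
        using no by simp
      finally show False
        by simp
    qed
    have inj: "a = b" if ab: "a \<in> A" "b \<in> A" "s \<in> S" "a \<rightarrow>\<^bsub>G\<^esub> s" "b \<rightarrow>\<^bsub>G\<^esub> s" for a b s
    proof (rule ccontr)
      assume "a \<noteq> b"
      then have "2 = card {a, b}"
        by simp
      also have "\<dots> \<le> card {t \<in> S. \<exists>x\<in>{a, b}. x \<rightarrow>\<^bsub>G\<^esub> t}"
        using ab disj by (intro card_le_card_neighbours_in_max_stable[OF S] stable_subset[OF A]) auto
      also have "\<dots> \<le> card {s}"
      proof (rule card_mono)
        show "{t \<in> S. \<exists>x\<in>{a, b}. x \<rightarrow>\<^bsub>G\<^esub> t} \<subseteq> {s}"
        proof
          fix t assume "t \<in> {t \<in> S. \<exists>x\<in>{a, b}. x \<rightarrow>\<^bsub>G\<^esub> t}"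
          then show "t \<in> {s}"
            using unique[rule_format, of s t a] unique[rule_format, of s t b] ab by auto
        qed
      qed simp
      finally show False
        by simp
    qed
    have "pairwise disjnt M"
    proof (rule pairwiseI)
      fix e f assume ef: "e \<in> M" "f \<in> M" "e \<noteq> f"
      obtain a s where e: "e = {a, s}" "a \<in> A" "s \<in> S" "a \<rightarrow>\<^bsub>G\<^esub> s"
        using ef(1) unfolding M_def mem_Collect_eq by metis
      obtain b t where f: "f = {b, t}" "b \<in> A" "t \<in> S" "b \<rightarrow>\<^bsub>G\<^esub> t"
        using ef(2) unfolding M_def mem_Collect_eq by metis
      have "a = b \<longleftrightarrow> s = t"
      proof
        assume "a = b"
        then show "s = t"
          using unique[rule_format, of s t a] e f by simp
      next
        assume "s = t"
        then show "a = b"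
          using inj[of a b s] e f by simp
      qed
      then have "a \<noteq> b" "s \<noteq> t"
        using e(1) f(1) ef(3) by auto
      moreover have "a \<noteq> t" "s \<noteq> b"
        using e f disj by auto
      ultimately show "disjnt e f"
        using e(1) f(1) by (simp add: disjnt_def)
    qed
    moreover have "M \<subseteq> edges G"
      unfolding M_def edges_def by blast
    moreover have "A \<subseteq> \<Union>M"
    proof
      fix a assume "a \<in> A"
      moreover from has_neighbour[OF this] obtain s where "s \<in> S" "a \<rightarrow>\<^bsub>G\<^esub> s"
        by blast
      ultimately have "{a, s} \<in> M"
        unfolding M_def by blast
      then show "a \<in> \<Union>M"
        by blast
    qed
    moreover have "\<forall>e\<in>M. \<exists>a\<in>A. \<exists>s\<in>S. e = {a, s}"
      unfolding M_def by blast
    ultimately have "matches_into G M A S"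
      by (simp add: matches_into_def matching_def)
    then show "\<exists>!M. matches_into G M A S"
    proof (rule ex1I)
      show "N = M" if "matches_into G N A S" for N
        unfolding M_def by (rule matches_into_eq_edges_between[OF that disj unique])
    qed
  qed
qed

lemma property_P1_iff_stable_square:
  assumes "S \<in> max_stable_sets G"
  shows "property_P1 G S \<longleftrightarrow> stable (square G) S"
  using assms property_P1_imp_stable_square stable_square_imp_property_P1
  by (auto simp: max_stable_sets_def)

section \<open>Perfect matchings of a symmetric difference\<close>

text \<open>
  A vertex of \<open>S - T\<close> has no neighbour in \<open>S\<close>, so its partner in \<open>T\<close> lies outside \<open>S\<close>. Hence the
  matching bounds \<open>|S - T|\<close> by \<open>|T - S|\<close>, and not only by \<open>|T|\<close>.
\<close>

lemma matches_into_Diff: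
  assumes "stable G S" and M: "matches_into G M (S - T) T"
  shows "matches_into G M (S - T) (T - S)"
proof -
  have "\<exists>a\<in>S - T. \<exists>s\<in>T - S. e = {a, s}" if e: "e \<in> M" for e
  proof -
    obtain a s where as: "a \<in> S - T" "s \<in> T" "e = {a, s}"
      using matches_intoD(4)[OF M e] by metis
    moreover have "e \<in> edges G"
      using matches_intoD(1)[OF M] e by (rule subsetD)
    ultimately have "s \<notin> S"
      using stable_no_edge[OF assms(1)] by (auto simp: edge_iff_dominates)
    with as show ?thesis
      by blast
  qed
  then show ?thesis
    using M by (simp add: matches_into_def)
qed

lemma card_le_if_matches_into:
  assumes S: "stable G S" and T: "stable G T" and M: "matches_into G M (S - T) T"
  shows "card S \<le> card T"
proof -
  have fin: "finite S" "finite T"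
    using finite_stable S T by auto
  obtain f where "inj_on f (S - T)" and "f ` (S - T) \<subseteq> T - S"
    by (rule matches_into_obtain_inj[OF matches_into_Diff[OF S M]]) auto
  then have "card (S - T) \<le> card (T - S)"
    using fin by (intro card_inj_on_le) auto
  then show ?thesis
    using card_less_sym_Diff[OF fin(2,1)] by linarith
qed

lemma perfect_matching_sym_diff_matches_into:
  assumes S: "stable G S" and T: "stable G T"
    and M: "perfect_matching (G \<restriction> sym_diff S T) M"
  shows "matches_into G M (S - T) T"
proof -
  have sub: "M \<subseteq> edges (G \<restriction> sym_diff S T)" and disj: "pairwise disjnt M"
    and cover: "\<Union>M = sym_diff S T"
    using M by (auto simp: perfect_matching_def matching_def)
  have "\<exists>a\<in>S - T. \<exists>s\<in>T. e = {a, s}" if e: "e \<in> M" for e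
  proof -
    have "e \<in> edges (G \<restriction> sym_diff S T)"
      using sub e by (rule subsetD)
    then obtain u v where uv: "e = {u, v}" "u \<rightarrow>\<^bsub>G\<^esub> v" "u \<in> sym_diff S T" "v \<in> sym_diff S T"
      unfolding edges_def mem_Collect_eq dominates_induce_subgraph_iff by metis
    then consider "u \<in> S - T" "v \<in> T" | "v \<in> S - T" "u \<in> T"
      using stable_no_edge[OF S, of u v] stable_no_edge[OF T, of u v] by blast
    then show ?thesis
      using uv(1) insert_commute[of u v "{}"] by cases metis+
  qed
  moreover have "M \<subseteq> edges G"
    using sub by (simp add: subset_iff edge_induce_subgraph_iff)
  moreover have "S - T \<subseteq> \<Union>M"
    unfolding cover by (rule Un_upper1)
  ultimately show ?thesis
    using disj by (simp add: matches_into_def matching_def)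
qed

text \<open>
  For equal cardinalities of \<open>S\<close> and \<open>T\<close> the two sides of the symmetric difference have the same
  size, so that a matching that saturates one of them is already perfect.
\<close>

lemma perfect_matching_sym_diff_iff:
  assumes S: "stable G S" and T: "stable G T" and card: "card S = card T"
  shows "perfect_matching (G \<restriction> sym_diff S T) M \<longleftrightarrow> matches_into G M (S - T) T"
proof
  assume M: "matches_into G M (S - T) T"
  have M': "matches_into G M (S - T) (T - S)"
    by (rule matches_into_Diff[OF S M])
  have fin: "finite S" "finite T"
    using finite_stable S T by auto
  obtain f where inj: "inj_on f (S - T)" and f: "f ` (S - T) \<subseteq> T - S"
      "\<And>a. a \<in> S - T \<Longrightarrow> {a, f a} \<in> M"
    by (rule matches_into_obtain_inj[OF M']) auto
  have "card (S - T) = card (T - S)"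
    using fin card card_Diff_subset_Int[of S T] card_Diff_subset_Int[of T S]
    by (simp add: Int_commute)
  then have "f ` (S - T) = T - S"
    using f(1) fin by (intro card_subset_eq) (auto simp: card_image[OF inj])
  then have "T - S \<subseteq> \<Union>M"
    using f(2) by blast
  moreover have "S - T \<subseteq> \<Union>M"
    by (rule matches_intoD(3)[OF M'])
  moreover have sub: "e \<subseteq> sym_diff S T" if "e \<in> M" for e
    using matches_intoD(4)[OF M' that] by auto
  ultimately have "\<Union>M = sym_diff S T"
    by blast
  moreover have "M \<subseteq> edges (G \<restriction> sym_diff S T)"
    using matches_intoD(1)[OF M] sub by (simp add: subset_iff edge_induce_subgraph_iff)
  moreover have "pairwise disjnt M"
    by (rule matches_intoD(2)[OF M])
  ultimately show "perfect_matching (G \<restriction> sym_diff S T) M"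
    by (simp add: perfect_matching_def matching_def)
qed (rule perfect_matching_sym_diff_matches_into[OF S T])

text \<open>
  By stability, every edge inside the symmetric difference joins \<open>S - T\<close> to \<open>T\<close>. All edges
  between these sets belong to the matching, because neighbours in \<open>T\<close> are unique.
\<close>

lemma perfect_matching_sym_diff_induced:
  assumes S: "stable G S" and T: "stable (square G) T"
    and M: "perfect_matching (G \<restriction> sym_diff S T) M"
  shows "induced_matching (G \<restriction> sym_diff S T) M"
  unfolding induced_matching_def
proof (intro conjI ballI impI)
  show "matching (G \<restriction> sym_diff S T) M"
    using M by (simp add: perfect_matching_def)
  then have disj: "pairwise disjnt M"
    by (simp add: matching_def)
  have T': "stable G T"
    and unique: "\<forall>v. \<forall>s\<in>T. \<forall>t\<in>T. v \<rightarrow>\<^bsub>G\<^esub> s \<longrightarrow> v \<rightarrow>\<^bsub>G\<^esub> t \<longrightarrow> s = t"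
    using T by (simp_all add: stable_square_iff)
  have "(S - T) \<inter> T = {}"
    by blast
  from matches_into_eq_edges_between[OF perfect_matching_sym_diff_matches_into[OF S T' M] this unique]
  have M_eq: "M = {{a, s} | a s. a \<in> S - T \<and> s \<in> T \<and> a \<rightarrow>\<^bsub>G\<^esub> s}" .
  fix e f x y assume ef: "e \<in> M" "f \<in> M" "e \<noteq> f" "x \<in> e" "y \<in> f"
  show "{x, y} \<notin> edges (G \<restriction> sym_diff S T)"
  proof
    assume "{x, y} \<in> edges (G \<restriction> sym_diff S T)"
    then have xy: "x \<rightarrow>\<^bsub>G\<^esub> y" "x \<in> sym_diff S T" "y \<in> sym_diff S T"
      by (simp_all add: edge_induce_subgraph_iff edge_iff_dominates)
    then consider "x \<in> S - T" "y \<in> T" | "y \<in> S - T" "x \<in> T"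
      using stable_no_edge[OF S, of x y] stable_no_edge[OF T', of x y] by blast
    then have "{x, y} \<in> M"
    proof cases
      case 1
      then show ?thesis
        using xy(1) unfolding M_eq by blast
    next
      case 2
      then have "{y, x} \<in> M"
        using graph_symmetric[OF xy(1)] unfolding M_eq by blast
      then show ?thesis
        by (simp add: insert_commute)
    qed
    \<comment> \<open>This edge of the matching meets both \<open>e\<close> and \<open>f\<close>, hence equals both.\<close>
    then have "{x, y} = e" "{x, y} = f"
      using ef pairwiseD[OF disj] by (auto simp: disjnt_def)
    with ef(3) show False
      by simp
  qed
qed

lemma square_stable_if_matches_into:
  assumes "S \<in> max_stable_sets G" and "T \<in> max_stable_sets (square G)"
    and "matches_into G M (S - T) T"
  shows "square_stable G"
  using assms card_le_if_matches_into[of S T M]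
  by (intro square_stableI) (auto simp: max_stable_sets_def stable_square_iff)

end

theorem theorem2p8:
  fixes G :: "('a,'b) pre_digraph"
  assumes "graph G" and "verts G \<noteq> {}" and "Digraph_Component.connected G"
  shows
    "(square_stable G \<longleftrightarrow> (\<exists>S\<^sub>0 \<in> max_stable_sets G. property_P1 G S\<^sub>0)) \<and>
     (square_stable G \<longleftrightarrow> (\<forall>S \<in> max_stable_sets (square G). property_P1 G S)) \<and>
     (square_stable G \<longleftrightarrow> (\<forall>S\<^sub>1 \<in> max_stable_sets G. \<forall>S\<^sub>2 \<in> max_stable_sets (square G).
        \<exists>!M. perfect_matching (G \<restriction> sym_diff S\<^sub>1 S\<^sub>2) M)) \<and>
     (square_stable G \<longleftrightarrow> (\<forall>S\<^sub>1 \<in> max_stable_sets G. \<forall>S\<^sub>2 \<in> max_stable_sets (square G).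
        \<exists>M. perfect_matching (G \<restriction> sym_diff S\<^sub>1 S\<^sub>2) M)) \<and>
     (square_stable G \<longleftrightarrow> (\<forall>S\<^sub>1 \<in> max_stable_sets G. \<forall>S\<^sub>2 \<in> max_stable_sets (square G).
        \<exists>M. perfect_matching (G \<restriction> sym_diff S\<^sub>1 S\<^sub>2) M \<and>
            induced_matching (G \<restriction> sym_diff S\<^sub>1 S\<^sub>2) M))"
proof -
  interpret graph G by fact
  let ?Pairs = "\<lambda>P. \<forall>S\<^sub>1 \<in> max_stable_sets G. \<forall>S\<^sub>2 \<in> max_stable_sets (square G).
    P (G \<restriction> sym_diff S\<^sub>1 S\<^sub>2)"
  obtain S T where S: "S \<in> max_stable_sets G" and T: "T \<in> max_stable_sets (square G)"
    using max_stable_sets_nonempty[OF finite_verts] max_stable_sets_nonempty[OF finite_verts_square]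
    by blast
  have stable_of_max: "stable G S" if "S \<in> max_stable_sets G" for S
    using that by (simp add: max_stable_sets_def)
  have stable_square_of_max: "stable (square G) T" if "T \<in> max_stable_sets (square G)" for T
    using that by (simp add: max_stable_sets_def)

  have i_ii: "square_stable G \<longleftrightarrow> (\<exists>S\<^sub>0 \<in> max_stable_sets G. property_P1 G S\<^sub>0)"
    unfolding square_stable_iff_max_stable_square
    by (rule bex_cong[OF refl]) (simp add: property_P1_iff_stable_square)

  have max_square_is_max: "T \<in> max_stable_sets G"
    if "square_stable G" "T \<in> max_stable_sets (square G)" for T
    using that by (simp add: max_stable_sets_def square_stable_def stable_square_iff)
  have P1: "\<forall>T \<in> max_stable_sets (square G). property_P1 G T" if "square_stable G"
  proof
    fix T assume T: "T \<in> max_stable_sets (square G)"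
    show "property_P1 G T"
      by (rule stable_square_imp_property_P1[OF max_square_is_max[OF that T] stable_square_of_max[OF T]])
  qed
  have matched: "\<exists>!M. matches_into G M (S - T) T"
    if S: "S \<in> max_stable_sets G" and P1: "property_P1 G T" for S T
  proof (rule property_P1D[OF P1])
    show "stable G (S - T)"
      by (rule stable_subset[OF stable_of_max[OF S]]) auto
  qed auto
  have "square_stable G" if iii: "\<forall>T \<in> max_stable_sets (square G). property_P1 G T"
  proof -
    obtain M where "matches_into G M (S - T) T"
      using matched[OF S bspec[OF iii T]] by (rule ex1E)
    then show ?thesis
      by (rule square_stable_if_matches_into[OF S T])
  qed
  with P1 have i_iii: "square_stable G \<longleftrightarrow> (\<forall>T \<in> max_stable_sets (square G). property_P1 G T)"
    by (rule iffI)

  have i_imp_iv: "?Pairs (\<lambda>H. \<exists>!M. perfect_matching H M)" if i: "square_stable G"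
  proof (intro ballI)
    fix S\<^sub>1 S\<^sub>2 assume S1: "S\<^sub>1 \<in> max_stable_sets G" and S2: "S\<^sub>2 \<in> max_stable_sets (square G)"
    have S2': "S\<^sub>2 \<in> max_stable_sets G"
      by (rule max_square_is_max[OF i S2])
    have "\<exists>!M. matches_into G M (S\<^sub>1 - S\<^sub>2) S\<^sub>2"
      by (rule matched[OF S1 bspec[OF P1[OF i] S2]])
    moreover have "card S\<^sub>1 = card S\<^sub>2"
      using S1 S2' by (simp add: max_stable_sets_def)
    ultimately show "\<exists>!M. perfect_matching (G \<restriction> sym_diff S\<^sub>1 S\<^sub>2) M"
      using perfect_matching_sym_diff_iff[OF stable_of_max[OF S1] stable_of_max[OF S2']] by simp
  qed
  have v_imp_i: "square_stable G" if v: "?Pairs (\<lambda>H. \<exists>M. perfect_matching H M)"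
  proof -
    obtain M where M: "perfect_matching (G \<restriction> sym_diff S T) M"
      using bspec[OF bspec[OF v S] T] by (rule exE)
    have "stable G T"
      using stable_square_of_max[OF T] by (simp add: stable_square_iff)
    from perfect_matching_sym_diff_matches_into[OF stable_of_max[OF S] this M]
    show ?thesis
      by (rule square_stable_if_matches_into[OF S T])
  qed
  have v_imp_vi: "?Pairs (\<lambda>H. \<exists>M. perfect_matching H M \<and> induced_matching H M)"
    if v: "?Pairs (\<lambda>H. \<exists>M. perfect_matching H M)"
  proof (intro ballI)
    fix S\<^sub>1 S\<^sub>2 assume S1: "S\<^sub>1 \<in> max_stable_sets G" and S2: "S\<^sub>2 \<in> max_stable_sets (square G)"
    obtain M where M: "perfect_matching (G \<restriction> sym_diff S\<^sub>1 S\<^sub>2) M"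
      using bspec[OF bspec[OF v S1] S2] by (rule exE)
    with perfect_matching_sym_diff_induced[OF stable_of_max[OF S1] stable_square_of_max[OF S2] M]
    show "\<exists>M. perfect_matching (G \<restriction> sym_diff S\<^sub>1 S\<^sub>2) M \<and> induced_matching (G \<restriction> sym_diff S\<^sub>1 S\<^sub>2) M"
      by (intro exI conjI)
  qed
  have iv_imp_v: "?Pairs (\<lambda>H. \<exists>M. perfect_matching H M)"
    if iv: "?Pairs (\<lambda>H. \<exists>!M. perfect_matching H M)"
    by (intro ballI ex1_implies_ex) (rule bspec[OF bspec[OF iv]])
  have vi_imp_v: "?Pairs (\<lambda>H. \<exists>M. perfect_matching H M)"
    if vi: "?Pairs (\<lambda>H. \<exists>M. perfect_matching H M \<and> induced_matching H M)"
    using vi by metis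

  note i_iv = iffI[OF i_imp_iv v_imp_i[OF iv_imp_v]]
  note i_v = iffI[OF iv_imp_v[OF i_imp_iv] v_imp_i]
  note i_vi = iffI[OF v_imp_vi[OF iv_imp_v[OF i_imp_iv]] v_imp_i[OF vi_imp_v]]
  show ?thesis
    by (rule conjI[OF i_ii conjI[OF i_iii conjI[OF i_iv conjI[OF i_v i_vi]]]])
qed

end
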